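(* Let $r$, $p$, $f$, $\phi$ satisfy the standing assumptions listed in the context, and let $\gamma$ be a piecewise constant argument of generalized type. Suppose that $$\int_\tau^\infty \frac{1}{r(s)}\,ds=\infty \qquad\text{and}\qquad \int_\tau^\infty p(s)\,ds=\infty .$$ Then every solution of the equation $$(r(t)x'(t))'+f(t,x(\gamma(t)))=0,\qquad t\ge\tau,$$ is oscillatory.
   Context: Piecewise constant argument of generalized type: let $(t_n)_{n\in\mathbb{Z}}$ and $(\zeta_n)_{n\in\mathbb{Z}}$ be real sequences with $t_n<t_{n+1}$ for all $n$, $\lim_{n\to\infty}t_n=\infty$, $\lim_{n\to-\infty}t_n=-\infty$, and $\zeta_n\in[t_n,t_{n+1}]$ for all $n$. Then $\gamma(t)=\zeta_n$ for $t\in I_n=[t_n,t_{n+1})$. Standing assumptions: $r$ is a continuous and locally integrable function on $[\tau,\infty)$; $f(t,x)$ is continuous on $[\tau,\infty)\times(-\infty,\infty)$ and $x f(t,x)>0$ for $t\ge\tau$ and $x\ne0$. Moreover there exist locally integrable functions $p(t)$ and $\phi(x)$ such that $p$ is continuous and nonnegative on $[\tau,\infty)$, $\phi$ is continuously differentiable and nondecreasing on $(-\infty,\infty)$ with $x\phi(x)>0$ for $x\neq0$, and $f(t,x)\ge p(t)\phi(x)$ for all $x\ne0$, $t\ge\tau$. Solution: a continuous function $x(t)$ is a solution on $[\tau,\infty)$ if (i) $x$ is continuously differentiable on $[\tau,\infty)$; (ii) $(r(t)x'(t))'$ exists for all $t\in[\tau,\infty)$, except possibly at the times $t_k$, $k\in\mathbb{N}$,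 where it has one-sided limits; (iii) $x$ satisfies the equation on the intervals $[t_k,t_{k+1})$, $k\in\mathbb{N}$. Oscillatory: a function $g$ defined on $[t_0,\infty)$ is oscillatory if there exist sequences $(a_n),(b_n)\subset[t_0,\infty)$ with $a_n\to\infty$, $b_n\to\infty$ as $n\to\infty$ and $g(a_n)\le 0\le g(b_n)$ for all sufficiently large $n$; that is, $g$ does not eventually become strictly positive or strictly negative.
   Formalization: The bound f(t,x) ≥ p(t)φ(x) for x≠0 is replaced by f(t,x)/φ(x) ≥ p(t), which reverses it for x<0 (as literally stated the claim fails: a negative solution can exist); r is assumed to have no zeros on [τ,∞) so that 1/r is defined. *)

theory Defs
  imports "HOL-Analysis.Analysis"
begin

definition piecewise_constant_argument ::
  "(int \<Rightarrow> real) \<Rightarrow> (int \<Rightarrow> real) \<Rightarrow> (real \<Rightarrow> real) \<Rightarrow> bool" where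
  "piecewise_constant_argument t \<zeta> \<gamma> \<longleftrightarrow>
     (\<forall>n. t n < t (n + 1)) \<and>
     filterlim t at_top at_top \<and> filterlim t at_bot at_bot \<and>
     (\<forall>n. \<zeta> n \<in> {t n..t (n + 1)}) \<and>
     (\<forall>n. \<forall>s\<in>{t n..<t (n + 1)}. \<gamma> s = \<zeta> n)"

definition locally_integrable_on :: "(real \<Rightarrow> real) \<Rightarrow> real set \<Rightarrow> bool" where
  "locally_integrable_on g S \<longleftrightarrow>
     (\<forall>K. compact K \<and> K \<subseteq> S \<longrightarrow> g absolutely_integrable_on K)"

definition integral_diverges_to_infinity :: "real \<Rightarrow> (real \<Rightarrow> real) \<Rightarrow> bool" where
  "integral_diverges_to_infinity \<tau> g \<longleftrightarrow>
     (\<forall>T\<ge>\<tau>. g integrable_on {\<tau>..T}) \<and>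
     filterlim (\<lambda>T. integral {\<tau>..T} g) at_top at_top"

(* Solutions on [\<tau>,\<infinity>) of (r x')' + f(s, x(\<gamma>(s))) = 0.
   Here x' is the derivative of x (one-sided at \<tau>) and D is (r x')', which is determined
   away from the switching times t_0, t_1, ... and whose values at these times are irrelevant.
   The derivative in the equation is taken within [t_k, t_(k+1)), so that it is the right
   derivative at s = t_k and the ordinary derivative in the interior.  If the interval
   containing \<tau> has \<zeta>_k < \<tau>, the equation refers there to a value of x to the left of \<tau>,
   about which nothing else is assumed. *)
definition is_solution ::
  "real \<Rightarrow> (real \<Rightarrow> real) \<Rightarrow> (real \<Rightarrow> real \<Rightarrow> real) \<Rightarrow> (int \<Rightarrow> real) \<Rightarrow> (real \<Rightarrow> real) \<Rightarrow>
   (real \<Rightarrow> real) \<Rightarrow> bool" where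
  "is_solution \<tau> r f t \<gamma> x \<longleftrightarrow>
     continuous_on {\<tau>..} x \<and>
     (\<exists>x' D.
        (\<forall>s\<ge>\<tau>. (x has_real_derivative x' s) (at s within {\<tau>..})) \<and>
        continuous_on {\<tau>..} x' \<and>
        (\<forall>s\<ge>\<tau>. s \<notin> range (\<lambda>k::nat. t (int k)) \<longrightarrow>
           ((\<lambda>s. r s * x' s) has_real_derivative D s) (at s within {\<tau>..})) \<and>
        (\<forall>k::nat. t (int k) \<ge> \<tau> \<longrightarrow> (\<exists>l. (D \<longlongrightarrow> l) (at_right (t (int k))))) \<and>
        (\<forall>k::nat. t (int k) > \<tau> \<longrightarrow> (\<exists>l. (D \<longlongrightarrow> l) (at_left (t (int k))))) \<and>
        (\<forall>k::nat. \<forall>s\<in>{t (int k)..<t (int k + 1)} \<inter> {\<tau>..}. \<exists>d.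
           ((\<lambda>s. r s * x' s) has_real_derivative d)
             (at s within {t (int k)..<t (int k + 1)} \<inter> {\<tau>..}) \<and>
           d + f s (x (\<gamma> s)) = 0))"

definition oscillatory_on :: "real \<Rightarrow> (real \<Rightarrow> real) \<Rightarrow> bool" where
  "oscillatory_on t0 g \<longleftrightarrow>
     (\<exists>a b :: nat \<Rightarrow> real. range a \<subseteq> {t0..} \<and> range b \<subseteq> {t0..} \<and>
        filterlim a at_top sequentially \<and> filterlim b at_top sequentially \<and>
        (\<forall>\<^sub>F n in sequentially. g (a n) \<le> 0 \<and> 0 \<le> g (b n)))"

(* f dominates p(s) \<phi>(x).  The bound is on the quotient f(s,x)/\<phi>(x): for x > 0 it says
   f(s,x) \<ge> p(s) \<phi>(x), and for x < 0, where f(s,x) and \<phi>(x) are negative, it says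
   |f(s,x)| \<ge> p(s) |\<phi>(x)|.  With f(s,x) \<ge> p(s) \<phi>(x) in place of the quotient for x < 0 the
   oscillation theorem fails: take \<tau> = 0, r = p = 1, \<phi>(x) = x, f(s,x) = x for x \<ge> 0 and
   f(s,x) = exp(-s) max(x,-1) for x < 0; then x(s) = exp(-s) - 2 - s is a negative solution. *)
definition dominates ::
  "real \<Rightarrow> (real \<Rightarrow> real \<Rightarrow> real) \<Rightarrow> (real \<Rightarrow> real) \<Rightarrow> (real \<Rightarrow> real) \<Rightarrow> bool" where
  "dominates \<tau> f p \<phi> \<longleftrightarrow> (\<forall>s\<ge>\<tau>. \<forall>x. x \<noteq> 0 \<longrightarrow> f s x / \<phi> x \<ge> p s)"

end

(* Suppose x > 0 from some t_k on.  Beyond t_k the deviated argument stays beyond t_k, so r x'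
   decreases.  It cannot become negative, since x' <= -c / r would drive x to -\<infinity>.  Hence x
   increases, x(\<gamma>(s)) >= x(t_k), and (r x')' <= -\<phi>(x(t_k)) p drives r x' to -\<infinity> after all.
   Eventually negative solutions are reduced to this case by the reflection x \<mapsto> -x. *)
theory Submission
  imports Defs
begin

section \<open>Failure of oscillation, and divergent integrals\<close>

lemma not_oscillatory_onE:
  assumes "\<not> oscillatory_on t0 g"
  obtains T where "T \<ge> t0" "\<And>s. s \<ge> T \<Longrightarrow> g s > 0"
  | T where "T \<ge> t0" "\<And>s. s \<ge> T \<Longrightarrow> g s < 0"
proof -
  have "(\<exists>T\<ge>t0. \<forall>s\<ge>T. g s > 0) \<or> (\<exists>T\<ge>t0. \<forall>s\<ge>T. g s < 0)"
  proof (rule ccontr)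
    assume "\<not> ?thesis"
    then have "\<forall>T\<ge>t0. \<exists>s\<ge>T. g s \<le> 0" "\<forall>T\<ge>t0. \<exists>s\<ge>T. g s \<ge> 0"
      by (meson not_le)+
    \<comment> \<open>The thresholds \<open>t0 + real n\<close> keep the chosen points in the domain
      and force both sequences to infinity.\<close>
    then have "\<exists>s\<ge>t0 + real n. g s \<le> 0" "\<exists>s\<ge>t0 + real n. g s \<ge> 0" for n
      by auto
    then obtain a b where ab: "a n \<ge> t0 + real n" "g (a n) \<le> 0" "b n \<ge> t0 + real n" "g (b n) \<ge> 0" for n
      by metis
    have "filterlim (\<lambda>n. t0 + real n) at_top sequentially"
      by (intro filterlim_tendsto_add_at_top[OF tendsto_const] filterlim_real_sequentially)
    then have "filterlim a at_top sequentially" "filterlim b at_top sequentially"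
      using ab by (auto elim!: filterlim_at_top_mono)
    moreover have "t0 \<le> a n" "t0 \<le> b n" for n
      using ab(1,3)[of n] by linarith+
    then have "range a \<subseteq> {t0..}" "range b \<subseteq> {t0..}"
      by auto
    ultimately have "oscillatory_on t0 g"
      unfolding oscillatory_on_def using ab(2,4) by (intro exI[of _ a] exI[of _ b]) auto
    with assms show False ..
  qed
  with that show ?thesis by blast
qed

lemma integral_diverges_to_infinity_tail:
  assumes g: "integral_diverges_to_infinity \<tau> g" and "a \<ge> \<tau>"
  obtains b where "b \<ge> a" "g integrable_on {a..b}" "integral {a..b} g \<ge> B"
proof -
  have int: "g integrable_on {\<tau>..T}" if "T \<ge> \<tau>" for T
    using g that by (simp add: integral_diverges_to_infinity_def)
  have "\<forall>\<^sub>F T in at_top. integral {\<tau>..T} g \<ge> B + integral {\<tau>..a} g"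
    using g by (simp add: integral_diverges_to_infinity_def filterlim_at_top)
  then obtain b where b: "b \<ge> a" "integral {\<tau>..b} g \<ge> B + integral {\<tau>..a} g"
    using eventually_conj[OF eventually_ge_at_top[of a]] eventually_happens by fastforce
  show thesis
  proof
    show "g integrable_on {a..b}"
      using int[of b] b \<open>a \<ge> \<tau>\<close> by (auto intro: integrable_on_subinterval)
    show "integral {a..b} g \<ge> B"
      using Henstock_Kurzweil_Integration.integral_combine[OF \<open>a \<ge> \<tau>\<close> b(1) int] b \<open>a \<ge> \<tau>\<close> by simp
  qed fact
qed

text \<open>Only nonvanishing of \<open>r\<close> is assumed, so its sign has to come from the
  divergence. A continuous function without zeros keeps one sign on a half-line, and a negative
  \<open>r\<close> would make every integral of \<open>1 / r\<close> nonpositive.\<close>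

lemma integral_diverges_to_infinity_inverse_imp_pos:
  assumes r: "continuous_on {\<tau>..} r" "\<forall>s\<ge>\<tau>. r s \<noteq> 0"
    and div: "integral_diverges_to_infinity \<tau> (\<lambda>s. 1 / r s)" and "s \<ge> \<tau>"
  shows "r s > 0"
proof (rule ccontr)
  assume "\<not> r s > 0"
  have neg: "r u \<le> 0" if "u \<ge> \<tau>" for u
  proof (rule ccontr)
    assume "\<not> r u \<le> 0"
    have "connected (r ` {\<tau>..})"
      by (intro connected_continuous_image r) auto
    then have "0 \<in> r ` {\<tau>..}"
      by (rule connectedD_interval[of _ "r s" "r u"])
        (use \<open>\<not> r s > 0\<close> \<open>\<not> r u \<le> 0\<close> \<open>s \<ge> \<tau>\<close> that in \<open>simp_all add: imageI\<close>)
    with r(2) show False by force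
  qed
  obtain b where b: "b \<ge> \<tau>" "(\<lambda>s. 1 / r s) integrable_on {\<tau>..b}" "integral {\<tau>..b} (\<lambda>s. 1 / r s) \<ge> 1"
    by (rule integral_diverges_to_infinity_tail[OF div order_refl])
  have "integral {\<tau>..b} (\<lambda>s. 1 / r s) \<le> integral {\<tau>..b} (\<lambda>s. 0)"
    using b neg by (intro integral_le) (auto simp: divide_nonneg_nonpos)
  with b(3) show False by simp
qed

text \<open>Here \<open>y\<close> stands for r x', \<open>F\<close> for f(s, x(\<gamma>(s))) and
  \<open>S\<close> for the switching times. Keeping these abstract, and asking for the sign of
  \<phi> only at positive arguments, lets one argument serve both x and its reflection -x.\<close>

lemma no_eventually_positive_solution:
  fixes x y r p F \<phi> \<gamma> :: "real \<Rightarrow> real"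
  assumes y: "continuous_on {T..} y" "\<And>a b. finite (S \<inter> {a..b})"
      "\<And>s. s > T \<Longrightarrow> s \<notin> S \<Longrightarrow> (y has_real_derivative - F s) (at s)"
    and x: "\<And>s. s \<ge> T \<Longrightarrow> (x has_real_derivative y s / r s) (at s within {T..})"
    and pos: "\<And>s. s \<ge> T \<Longrightarrow> x s > 0"
    and r: "\<And>s. s \<ge> T \<Longrightarrow> r s > 0"
    and \<gamma>: "\<And>s. s \<ge> T \<Longrightarrow> \<gamma> s \<ge> T"
    and p: "\<And>s. s \<ge> T \<Longrightarrow> p s \<ge> 0"
    and F: "\<And>s. s \<ge> T \<Longrightarrow> F s \<ge> p s * \<phi> (x (\<gamma> s))"
    and \<phi>: "mono \<phi>" "\<And>u. u > 0 \<Longrightarrow> \<phi> u > 0"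
    and "T \<ge> \<tau>"
    and r_div: "integral_diverges_to_infinity \<tau> (\<lambda>s. 1 / r s)"
    and p_div: "integral_diverges_to_infinity \<tau> p"
  shows False
proof -
  \<comment> \<open>\<open>F\<close> may jump at the switching times, where \<open>y\<close> need
    not be differentiable. Since \<open>y\<close> is continuous and only finitely many such points
    lie in a bounded interval, the fundamental theorem still applies; it also supplies the
    integrability of \<open>F\<close>.\<close>
  have y_int: "(F has_integral y a - y b) {a..b}" if "T \<le> a" "a \<le> b" for a b
  proof -
    have "((\<lambda>s. - F s) has_integral y b - y a) {a..b}"
    proof (rule fundamental_theorem_of_calculus_interior_strong[OF y(2)[of a b] \<open>a \<le> b\<close>])
      show "continuous_on {a..b} y"
        by (rule continuous_on_subset[OF y(1)]) (use that in auto)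
      show "(y has_vector_derivative - F s) (at s)" if "s \<in> {a<..<b} - S \<inter> {a..b}" for s
        using y(3)[of s] that \<open>T \<le> a\<close> by (auto simp add: has_real_derivative_iff_has_vector_derivative[symmetric])
    qed
    from has_integral_neg[OF this] show ?thesis by simp
  qed
  have x_int: "((\<lambda>s. y s / r s) has_integral x b - x a) {a..b}" if "T \<le> a" "a \<le> b" for a b
  proof (rule fundamental_theorem_of_calculus[OF \<open>a \<le> b\<close>])
    show "(x has_vector_derivative y s / r s) (at s within {a..b})" if "s \<in> {a..b}" for s
      using has_field_derivative_subset[OF x, of s "{a..b}"] that \<open>T \<le> a\<close>
      by (auto simp: has_real_derivative_iff_has_vector_derivative)
  qed
  have F_nonneg: "F s \<ge> 0" if "s \<ge> T" for s
    by (rule order_trans[OF mult_nonneg_nonneg F])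
      (use that p \<phi>(2) pos \<gamma> in \<open>auto intro: less_imp_le\<close>)
  have y_antimono: "y b \<le> y a" if "T \<le> a" "a \<le> b" for a b
    using has_integral_nonneg[OF y_int[OF that]] F_nonneg that by simp
  have y_nonneg: "y a \<ge> 0" if "a \<ge> T" for a
  proof (rule ccontr)
    assume "\<not> y a \<ge> 0"
    \<comment> \<open>The bound is chosen so that multiplying by the negative number
      \<open>y a\<close> gives \<open>x b - x a \<le> - x a\<close>, that is,
      \<open>x b \<le> 0\<close>.\<close>
    obtain b where b: "b \<ge> a" "(\<lambda>s. 1 / r s) integrable_on {a..b}"
        "integral {a..b} (\<lambda>s. 1 / r s) \<ge> x a / - y a"
      by (rule integral_diverges_to_infinity_tail[OF r_div order_trans[OF \<open>T \<ge> \<tau>\<close> \<open>a \<ge> T\<close>]])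
    have "x b - x a \<le> y a * integral {a..b} (\<lambda>s. 1 / r s)"
    proof (rule has_integral_le[OF x_int[OF that b(1)]])
      show "((\<lambda>s. y a * (1 / r s)) has_integral y a * integral {a..b} (\<lambda>s. 1 / r s)) {a..b}"
        by (intro has_integral_mult_right integrable_integral b)
      show "y s / r s \<le> y a * (1 / r s)" if "s \<in> {a..b}" for s
        using y_antimono[of a s] r[of s] \<open>a \<ge> T\<close> that by (simp add: divide_right_mono)
    qed
    also have "\<dots> \<le> y a * (x a / - y a)"
      using b(3) \<open>\<not> y a \<ge> 0\<close> by (intro mult_left_mono_neg) auto
    also have "\<dots> = - x a"
      using \<open>\<not> y a \<ge> 0\<close> by simp
    finally show False
      using pos[of b] that b(1) by simp
  qed
  have x_mono: "x T \<le> x s" if "s \<ge> T" for s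
    using has_integral_nonneg[OF x_int[OF order_refl that]] y_nonneg r by (simp add: divide_nonneg_pos)
  \<comment> \<open>As \<gamma>(s) stays beyond \<open>T\<close> and \<open>x\<close> is at least
    \<open>x T\<close> there, monotonicity of \<phi> makes \<open>c\<close> a positive lower bound
    for \<phi>(x(\<gamma>(s))).\<close>
  define c where "c = \<phi> (x T)"
  have "c > 0"
    using pos[of T] \<phi>(2) by (simp add: c_def)
  \<comment> \<open>With this much mass of \<open>p\<close>, \<open>y\<close> falls by at least
    \<open>y T + 1\<close>, hence to -1 or below, against \<open>y_nonneg\<close>.\<close>
  obtain b where b: "b \<ge> T" "p integrable_on {T..b}" "integral {T..b} p \<ge> (y T + 1) / c"
    by (rule integral_diverges_to_infinity_tail[OF p_div \<open>T \<ge> \<tau>\<close>])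
  have "c * integral {T..b} p \<le> y T - y b"
  proof (rule has_integral_le[OF _ y_int[OF order_refl b(1)]])
    show "((\<lambda>s. c * p s) has_integral c * integral {T..b} p) {T..b}"
      by (intro has_integral_mult_right integrable_integral b)
    show "c * p s \<le> F s" if "s \<in> {T..b}" for s
    proof -
      have "c * p s \<le> p s * \<phi> (x (\<gamma> s))"
        unfolding c_def mult.commute[of "\<phi> (x T)"] using that p x_mono \<gamma>
        by (intro mult_left_mono monoD[OF \<phi>(1)]) auto
      also have "\<dots> \<le> F s"
        using F that by simp
      finally show ?thesis .
    qed
  qed
  moreover have "c * integral {T..b} p \<ge> y T + 1"
    using b(3) \<open>c > 0\<close> by (simp add: field_simps)
  ultimately show False
    using y_nonneg[OF b(1)] by simp
qed

text \<open>The argument may be delayed or advanced, but it never leaves the closure of the interval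
  containing \<open>s\<close>. Switching times are therefore barriers: from \<open>t (int k)\<close>
  on, \<gamma> does not look back past \<open>t (int k)\<close>. The index \<open>m\<close> is
  natural because the equation is imposed only on intervals with natural index.\<close>

lemma piecewise_constant_argument_intervalE:
  assumes "piecewise_constant_argument t \<zeta> \<gamma>" and "t (int k) \<le> s"
  obtains m :: nat where "k \<le> m" "t (int m) \<le> s" "s < t (int m + 1)" "\<gamma> s \<ge> t (int k)"
proof -
  have top: "filterlim t at_top at_top"
    using assms(1) by (simp add: piecewise_constant_argument_def)
  have step: "t n < t (n + 1)" and \<zeta>: "\<zeta> n \<ge> t n"
    and \<gamma>: "t n \<le> s \<Longrightarrow> s < t (n + 1) \<Longrightarrow> \<gamma> s = \<zeta> n" for n s
    using assms(1) by (auto simp: piecewise_constant_argument_def)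
  have "\<forall>\<^sub>F n in sequentially. t (int n) > s"
    using filterlim_compose[OF top filterlim_int_sequentially] by (simp add: filterlim_at_top_dense)
  then obtain j where "t (int j) > s" "j \<ge> k"
    using eventually_conj[OF eventually_ge_at_top[of k]] eventually_happens by fastforce
  \<comment> \<open>Descending from an index whose switching time exceeds \<open>s\<close>, one
    stops at the first switching time not after \<open>s\<close>; this happens at \<open>k\<close>
    at the latest.\<close>
  then have "\<exists>m\<ge>k. t (int m) \<le> s \<and> s < t (int (Suc m))"
  proof (induction j)
    case 0
    with assms(2) show ?case by simp
  next
    case (Suc j)
    show ?case
    proof (cases "t (int j) \<le> s")
      case True
      with Suc.prems assms(2) show ?thesis
        by (metis le_SucE linorder_not_le)
    next
      case False
      with Suc assms(2) show ?thesis
        by (metis le_SucE linorder_not_le)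
    qed
  qed
  then obtain m where m: "k \<le> m" "t (int m) \<le> s" "s < t (int m + 1)"
    by (auto simp: add.commute)
  have "t (int k) \<le> t (int m)"
    by (rule lift_Suc_mono_le[OF _ m(1)]) (use less_imp_le[OF step] in \<open>simp add: add.commute[of 1]\<close>)
  also have "\<dots> \<le> \<gamma> s"
    using \<gamma>[OF m(2,3)] \<zeta> by simp
  finally show thesis
    using m that by blast
qed

section \<open>The oscillation theorem\<close>

theorem theorem1:
  fixes \<tau> :: real
    and r p \<phi> \<gamma> x :: "real \<Rightarrow> real"
    and f :: "real \<Rightarrow> real \<Rightarrow> real"
    and t \<zeta> :: "int \<Rightarrow> real"
  assumes "piecewise_constant_argument t \<zeta> \<gamma>"
    and "continuous_on {\<tau>..} r" and "locally_integrable_on r {\<tau>..}"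
    and "\<forall>s\<ge>\<tau>. r s \<noteq> 0"
    and "continuous_on ({\<tau>..} \<times> UNIV) (\<lambda>(s, y). f s y)"
    and "\<forall>s\<ge>\<tau>. \<forall>y. y \<noteq> 0 \<longrightarrow> y * f s y > 0"
    and "continuous_on {\<tau>..} p" and "locally_integrable_on p {\<tau>..}"
    and "\<forall>s\<ge>\<tau>. p s \<ge> 0"
    and "locally_integrable_on \<phi> UNIV"
    and "\<phi> C1_differentiable_on UNIV" and "mono \<phi>"
    and "\<forall>y. y \<noteq> 0 \<longrightarrow> y * \<phi> y > 0"
    and "dominates \<tau> f p \<phi>"
    and "integral_diverges_to_infinity \<tau> (\<lambda>s. 1 / r s)"
    and "integral_diverges_to_infinity \<tau> p"
    and "is_solution \<tau> r f t \<gamma> x"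
  shows "oscillatory_on \<tau> x"
proof (rule ccontr)
  note pca = assms(1) and r_cont = assms(2) and f_sign = assms(6) and p_nonneg = assms(9)
    and \<phi>_mono = assms(12) and \<phi>_sign = assms(13) and dom = assms(14)
    and r_div = assms(15) and p_div = assms(16) and sol = assms(17)
  let ?S = "range (\<lambda>k::nat. t (int k))"
  have r_pos: "r s > 0" if "s \<ge> \<tau>" for s
    using integral_diverges_to_infinity_inverse_imp_pos[OF r_cont assms(4) r_div that] .
  obtain x' where x': "\<And>s. s \<ge> \<tau> \<Longrightarrow> (x has_real_derivative x' s) (at s within {\<tau>..})"
      "continuous_on {\<tau>..} x'"
    and eq: "\<And>k s. s \<in> {t (int k)..<t (int k + 1)} \<inter> {\<tau>..} \<Longrightarrow> \<exists>d.
           ((\<lambda>s. r s * x' s) has_real_derivative d)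
             (at s within {t (int k)..<t (int k + 1)} \<inter> {\<tau>..}) \<and> d + f s (x (\<gamma> s)) = 0"
    using sol unfolding is_solution_def by blast
  \<comment> \<open>The equation gives a derivative only within a half-open interval cut off at
    \<tau>. A point beyond \<tau> that is not a switching time is interior to that set, so the
    derivative there is two-sided.\<close>
  have deriv: "((\<lambda>s. r s * x' s) has_real_derivative - f s (x (\<gamma> s))) (at s)"
    if k: "t (int k) \<ge> \<tau>" and s: "s > t (int k)" "s \<notin> ?S" for k s
  proof -
    obtain m where m: "t (int m) \<le> s" "s < t (int m + 1)"
      using piecewise_constant_argument_intervalE[OF pca] s(1) by (metis less_imp_le)
    let ?I = "{t (int m)..<t (int m + 1)} \<inter> {\<tau>..}"
    have "t (int m) \<noteq> s"
      using s(2) by blast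
    then have "s \<in> {max (t (int m)) \<tau><..<t (int m + 1)}"
      using m k s(1) by auto
    moreover have "{max (t (int m)) \<tau><..<t (int m + 1)} \<subseteq> ?I"
      by auto
    ultimately have "s \<in> interior ?I"
      by (meson interiorI open_greaterThanLessThan)
    moreover from this have "s \<in> ?I"
      using interior_subset by blast
    ultimately show ?thesis
      using eq[of s m] at_within_interior[of s ?I] by (metis add_eq_0_iff2)
  qed
  have late: "\<forall>\<^sub>F k in sequentially. t (int k) > T" for T
  proof -
    have "filterlim t at_top at_top"
      using pca by (simp add: piecewise_constant_argument_def)
    then have "filterlim (\<lambda>n. t (int n)) at_top sequentially"
      by (rule filterlim_compose[OF _ filterlim_int_sequentially])
    then show ?thesis
      by (simp add: filterlim_at_top_dense)
  qed
  have S_fin: "finite (?S \<inter> {a..b})" for a b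
  proof -
    obtain N where "t (int k) > b" if "k \<ge> N" for k
      using late[of b] unfolding eventually_sequentially by blast
    then have "?S \<inter> {a..b} \<subseteq> (\<lambda>k. t (int k)) ` {..<N}"
      by (force simp: not_le[symmetric])
    then show ?thesis
      by (rule finite_subset) simp
  qed
  assume "\<not> oscillatory_on \<tau> x"
  then show False
  proof (cases rule: not_oscillatory_onE)
    case (1 T)
    \<comment> \<open>The argument starts at a switching time rather than at \<open>T\<close>, so
      that x(\<gamma>(s)) is also evaluated where the sign of x is known.\<close>
    obtain k :: nat where k: "t (int k) > T"
      using eventually_happens[OF late] by auto
    let ?T = "t (int k)"
    have "?T \<ge> \<tau>"
      using k 1(1) by simp
    show False
    proof (rule no_eventually_positive_solution[where T = ?T and y = "\<lambda>s. r s * x' s"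
          and F = "\<lambda>s. f s (x (\<gamma> s))" and S = ?S and \<gamma> = \<gamma> and x = x])
      show "continuous_on {?T..} (\<lambda>s. r s * x' s)"
        using \<open>?T \<ge> \<tau>\<close>
        by (intro continuous_on_mult continuous_on_subset[OF r_cont] continuous_on_subset[OF x'(2)]) auto
      show "((\<lambda>s. r s * x' s) has_real_derivative - f s (x (\<gamma> s))) (at s)"
        if "s > ?T" "s \<notin> ?S" for s
        using deriv[OF \<open>?T \<ge> \<tau>\<close> that] .
      show "(x has_real_derivative r s * x' s / r s) (at s within {?T..})" if "s \<ge> ?T" for s
        using has_field_derivative_subset[OF x'(1), of s "{?T..}"] r_pos[of s] that \<open>?T \<ge> \<tau>\<close> by simp
      show \<gamma>: "\<gamma> s \<ge> ?T" if "s \<ge> ?T" for s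
        using piecewise_constant_argument_intervalE[OF pca that] by blast
      show "p s * \<phi> (x (\<gamma> s)) \<le> f s (x (\<gamma> s))" if "s \<ge> ?T" for s
      proof -
        have "x (\<gamma> s) > 0"
          using 1(2) \<gamma>[OF that] k by simp
        moreover from this have "\<phi> (x (\<gamma> s)) > 0"
          using \<phi>_sign by (metis less_numeral_extra(3) zero_less_mult_pos)
        ultimately show ?thesis
          using dom[unfolded dominates_def, rule_format, of s "x (\<gamma> s)"] that \<open>?T \<ge> \<tau>\<close>
          by (simp add: pos_le_divide_eq)
      qed
      show "\<phi> u > 0" if "u > 0" for u
        using \<phi>_sign that by (metis less_numeral_extra(3) zero_less_mult_pos)
    qed (use 1 k S_fin \<open>?T \<ge> \<tau>\<close> r_pos p_nonneg \<phi>_mono r_div p_div in auto)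
  next
    case (2 T)
    obtain k :: nat where k: "t (int k) > T"
      using eventually_happens[OF late] by auto
    let ?T = "t (int k)"
    have "?T \<ge> \<tau>"
      using k 2(1) by simp
    have \<phi>_neg: "\<phi> u < 0" if "u < 0" for u
      using \<phi>_sign that by (metis less_irrefl not_less_iff_gr_or_eq mult_neg_pos mult_zero_right)
    show False
    \<comment> \<open>The function -x solves the equation with nonlinearity -f(s,-u), and u
      \<mapsto> -\<phi>(-u) is again nondecreasing and positive for u > 0.\<close>
    proof (rule no_eventually_positive_solution[where T = ?T and y = "\<lambda>s. - (r s * x' s)"
          and F = "\<lambda>s. - f s (x (\<gamma> s))" and S = ?S and \<gamma> = \<gamma> and x = "\<lambda>s. - x s"
          and \<phi> = "\<lambda>u. - \<phi> (- u)"])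
      show "continuous_on {?T..} (\<lambda>s. - (r s * x' s))"
        using \<open>?T \<ge> \<tau>\<close>
        by (intro continuous_on_minus continuous_on_mult
            continuous_on_subset[OF r_cont] continuous_on_subset[OF x'(2)]) auto
      show "((\<lambda>s. - (r s * x' s)) has_real_derivative - (- f s (x (\<gamma> s)))) (at s)"
        if "s > ?T" "s \<notin> ?S" for s
        using DERIV_minus[OF deriv[OF \<open>?T \<ge> \<tau>\<close> that]] .
      show "((\<lambda>s. - x s) has_real_derivative - (r s * x' s) / r s) (at s within {?T..})"
        if "s \<ge> ?T" for s
        using DERIV_minus[OF has_field_derivative_subset[OF x'(1), of s "{?T..}"]] r_pos[of s]
          that \<open>?T \<ge> \<tau>\<close> by simp
      show \<gamma>: "\<gamma> s \<ge> ?T" if "s \<ge> ?T" for s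
        using piecewise_constant_argument_intervalE[OF pca that] by blast
      \<comment> \<open>Since \<phi>(x(\<gamma>(s))) is negative, clearing the denominator in
        \<open>dominates\<close> reverses the inequality to f \<le> p \<phi>, and negating both
        sides gives the lower bound for the reflected problem.\<close>
      show "p s * - \<phi> (- (- x (\<gamma> s))) \<le> - f s (x (\<gamma> s))" if "s \<ge> ?T" for s
      proof -
        have "x (\<gamma> s) < 0"
          using 2(2) \<gamma>[OF that] k by simp
        moreover from this have "\<phi> (x (\<gamma> s)) < 0"
          by (rule \<phi>_neg)
        ultimately show ?thesis
          using dom[unfolded dominates_def, rule_format, of s "x (\<gamma> s)"] that \<open>?T \<ge> \<tau>\<close>
          by (simp add: neg_le_divide_eq)
      qed
      show "mono (\<lambda>u. - \<phi> (- u))"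
        using \<phi>_mono by (simp add: mono_def)
    qed (use 2 k S_fin \<open>?T \<ge> \<tau>\<close> r_pos p_nonneg \<phi>_neg r_div p_div in auto)
  qed
qed

end
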